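(* For every integer $m\geqslant 0$ and every vector $A=(a_1,a_2,\dots,a_m)$ with non-negative integer coordinates (with $A=\emptyset$ if $m=0$), the polynomial $\Delta(A;t)\in\mathbb{Z}[t]$ is a $3$-special polynomial.
   Context: The polynomial $\Delta(A;t)=\Delta(a_1,\dots,a_m;t)\in\mathbb{Z}[t]$ is defined recursively by $\Delta(\emptyset;t):=1$, $\Delta(0;t):=0$, $\Delta(a;t):=t+t^2+\dots+t^a$ for integers $a>0$, and for $m\geqslant 2$ $$\Delta(a_1,\dots,a_m;t):=\Delta(a_1,\dots,a_{m-1};t)\cdot\Delta(a_m;t)-\Delta(a_1,\dots,a_{m-2};t)\cdot t^{a_m+1},$$ where for $m=2$ the expression $\Delta(a_1,\dots,a_{m-2};t)$ means $\Delta(\emptyset;t)=1$. Let $K:=\mathbb{Z}[T]/(T^3-1)$. For $g(t)=\sum_{h\geqslant 0}a_ht^h\in\mathbb{Z}[t]$ and $i\in\{0,1,2\}$ put $R_i(g(t)):=\sum_{h\equiv i \bmod 3}a_h$, and define $R:\mathbb{Z}[t]\to K$ by $R(g(t)):=R_0(g(t))+R_1(g(t))T+R_2(g(t))T^2$. An element $a+bT+cT^2\in K$ (with $a,b,c\in\mathbb{Z}$) is called special if either $a=b=c$, or $|a-b|+|a-c|+|b-c|=2$. A polynomial $g(t)\in\mathbb{Z}[t]$ is called $3$-special if $R(g(t))$ is a special element of $K$. *)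

theory Defs
  imports "HOL-Computational_Algebra.Polynomial" "HOL-Number_Theory.Cong"
begin

(* \<Delta>(0;t) = 0 is the case of the empty sum in the second equation. *)
function Delta :: "nat list \<Rightarrow> int poly" where
  "Delta [] = 1"
| "Delta [a] = (\<Sum>i=1..a. monom 1 i)"
| "Delta (A @ [b, a]) = Delta (A @ [b]) * Delta [a] - Delta A * monom 1 (a + 1)"
proof -
  fix P :: bool and x :: "nat list"
  assume *: "x = [] \<Longrightarrow> P" "\<And>a. x = [a] \<Longrightarrow> P" "\<And>A b a. x = A @ [b, a] \<Longrightarrow> P"
  show P
  proof (cases x rule: rev_cases)
    case (snoc y a)
    then show P using * by (cases y rule: rev_cases) auto
  qed (use * in auto)
qed auto
termination by (relation "measure length") auto

definition cube_rel :: "int poly \<Rightarrow> int poly \<Rightarrow> bool" where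
  "cube_rel p q \<longleftrightarrow> (monom 1 3 - 1) dvd (p - q)"

lemma equivp_cube_rel: "equivp cube_rel"
proof (rule equivpI)
  show "reflp cube_rel" by (simp add: reflp_def cube_rel_def)
  show "symp cube_rel" by (metis cube_rel_def dvd_minus_iff minus_diff_eq sympI)
  show "transp cube_rel"
  proof (rule transpI)
    fix p q r assume "cube_rel p q" "cube_rel q r"
    then have "monom 1 3 - 1 dvd (p - q) + (q - r)" unfolding cube_rel_def by (rule dvd_add)
    then show "cube_rel p r" by (simp add: cube_rel_def)
  qed
qed

(* The ring \<int>[T]/(T^3 - 1). *)
quotient_type K = "int poly" / cube_rel
  by (rule equivp_cube_rel)

instantiation K :: comm_ring_1
begin

lift_definition zero_K :: K is 0 .
lift_definition one_K :: K is 1 .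
lift_definition plus_K :: "K \<Rightarrow> K \<Rightarrow> K" is "(+)"
  unfolding cube_rel_def by (metis add_diff_add dvd_add)
lift_definition uminus_K :: "K \<Rightarrow> K" is uminus
  unfolding cube_rel_def by (metis minus_diff_minus dvd_minus_iff)
lift_definition minus_K :: "K \<Rightarrow> K \<Rightarrow> K" is "(-)"
proof -
  fix p q r s :: "int poly"
  assume "cube_rel p q" "cube_rel r s"
  then have "monom 1 3 - 1 dvd (p - q) - (r - s)" unfolding cube_rel_def by (rule dvd_diff)
  then show "cube_rel (p - r) (q - s)" by (simp add: cube_rel_def algebra_simps)
qed
lift_definition times_K :: "K \<Rightarrow> K \<Rightarrow> K" is "(*)"
proof -
  fix p q r s :: "int poly"
  assume "cube_rel p q" "cube_rel r s"
  then have "monom 1 3 - 1 dvd (p - q) * r + q * (r - s)"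
    unfolding cube_rel_def by simp
  then show "cube_rel (p * r) (q * s)" by (simp add: cube_rel_def algebra_simps)
qed

instance
proof
  have "\<not> cube_rel 0 1"
  proof
    assume "cube_rel 0 1"
    then obtain r :: "int poly" where "0 - 1 = (monom 1 3 - 1) * r"
      unfolding cube_rel_def by (elim dvdE)
    then have "poly (0 - 1) 1 = poly ((monom 1 3 - 1) * r) 1" by simp
    then show False by (simp add: poly_monom)
  qed
  then show "(0::K) \<noteq> 1" by transfer
qed (transfer; simp add: cube_rel_def algebra_simps)+

end

lift_definition T :: K is "monom 1 1" .

definition R_coeff :: "nat \<Rightarrow> int poly \<Rightarrow> int" where
  "R_coeff i g = (\<Sum>h | h \<le> degree g \<and> [h = i] (mod 3). coeff g h)"

definition R :: "int poly \<Rightarrow> K" where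
  "R g = of_int (R_coeff 0 g) + of_int (R_coeff 1 g) * T + of_int (R_coeff 2 g) * T ^ 2"

(* The coefficients a, b, c of an element of K are unique, see K_coeffs_unique. *)
definition special :: "K \<Rightarrow> bool" where
  "special x \<longleftrightarrow> (\<exists>a b c :: int. x = of_int a + of_int b * T + of_int c * T ^ 2 \<and>
     (a = b \<and> b = c \<or> \<bar>a - b\<bar> + \<bar>a - c\<bar> + \<bar>b - c\<bar> = 2))"

definition three_special :: "int poly \<Rightarrow> bool" where
  "three_special g \<longleftrightarrow> special (R g)"

lemma of_int_K: "of_int n = abs_K [:n:]"
proof -
  have nat: "of_nat k = abs_K [:int k:]" for k
    by (induction k) (simp_all add: zero_K_def one_K_def plus_K.abs_eq one_pCons add.commute)
  show ?thesis
    by (cases n rule: int_cases2) (simp_all add: nat uminus_K.abs_eq)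
qed

lemma K_coeffs_eq_abs: "of_int a + of_int b * T + of_int c * T ^ 2 = abs_K [:a, b, c:]"
  by (simp add: of_int_K T_def plus_K.abs_eq times_K.abs_eq power2_eq_square monom_altdef)

lemma K_coeffs_unique:
  assumes "of_int a + of_int b * T + of_int c * T ^ 2 =
    of_int a' + of_int b' * T + of_int c' * T ^ 2"
  shows "a = a' \<and> b = b' \<and> c = c'"
proof -
  let ?d = "[:a - a', b - b', c - c':]"
  have "monom 1 3 - 1 dvd ?d"
    using assms by (simp add: K_coeffs_eq_abs K.abs_eq_iff cube_rel_def)
  moreover have "monom 1 3 - 1 = [:-1, 0, 0, 1 :: int:]"
    by (simp add: monom_altdef power3_eq_cube one_pCons)
  moreover have "degree ?d < 3" by simp
  ultimately have "?d = 0"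
    using dvd_imp_degree_le[of "[:-1, 0, 0, 1:]" ?d] by fastforce
  then show ?thesis by simp
qed

end

theory Submission
  imports Defs Complex_Main
begin

text \<open>
  Evaluating at a primitive cube root of unity \<open>\<omega>\<close> factors through \<open>R\<close>, and
  \<open>\<bar>a + b \<omega> + c \<omega>\<^sup>2\<bar>\<^sup>2 = ((a - b)\<^sup>2 + (a - c)\<^sup>2 + (b - c)\<^sup>2) / 2\<close>; so \<open>g\<close> is
  3-special iff \<open>g(\<omega>)\<close> is zero or of modulus 1. At \<open>t = \<omega>\<close> the recursion depends only
  on \<open>a\<^sub>m mod 3\<close>, and it turns the ratio \<open>r\<close> of two consecutive values into \<open>- \<omega> / r\<close>,
  \<open>\<omega> - \<omega>\<^sup>2 / r\<close> or \<open>- 1 - 1 / r\<close>. All three maps preserve the set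
  \<open>{\<infinity>, 0, \<omega>, - 1}\<close>, which contains the initial ratio \<open>\<infinity>\<close>. Hence one of two consecutive
  values is always a unit, and the other is a unit or zero.
\<close>

definition omega :: complex where
  "omega = Complex (- 1 / 2) (sqrt 3 / 2)"

lemma omega_square: "omega ^ 2 = - 1 - omega"
  by (simp add: omega_def power2_eq_square complex_eq_iff)

lemma omega_cube: "omega ^ 3 = 1"
proof -
  have "omega ^ 3 - 1 = (omega - 1) * (omega ^ 2 + omega + 1)"
    by (simp add: algebra_simps power3_eq_cube power2_eq_square)
  then show ?thesis by (simp add: omega_square)
qed

lemma norm_omega [simp]: "cmod omega = 1"
  by (simp add: omega_def cmod_def power_divide)

lemma omega_power_mod: "omega ^ n = omega ^ (n mod 3)"
proof -
  have "omega ^ n = omega ^ (3 * (n div 3) + n mod 3)" by simp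
  also have "\<dots> = omega ^ (n mod 3)"
    unfolding power_add power_mult omega_cube by simp
  finally show ?thesis .
qed

lemma mod_3_cases:
  "n mod 3 = 0 \<and> Suc n mod 3 = 1 \<or> n mod 3 = 1 \<and> Suc n mod 3 = 2 \<or>
    n mod 3 = 2 \<and> Suc n mod 3 = 0"
  by presburger

text \<open>The shifted exponent is the one in the factor \<open>t^(a + 1)\<close> of the
  recursion.\<close>

lemma omega_power_Suc:
  "omega ^ Suc n = (if n mod 3 = 0 then omega else if n mod 3 = 1 then - 1 - omega else 1)"
  by (subst omega_power_mod) (use mod_3_cases[of n] in \<open>auto simp: omega_square\<close>)

lemma norm_omega_combination:
  "(cmod (of_int a + of_int b * omega + of_int c * omega ^ 2))\<^sup>2 =
    of_int ((a - b)\<^sup>2 + (a - c)\<^sup>2 + (b - c)\<^sup>2) / 2"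
proof -
  have "of_int a + of_int b * omega + of_int c * omega ^ 2 =
      Complex (a - b / 2 - c / 2) ((b - c) * (sqrt 3 / 2))"
    unfolding omega_square by (simp add: omega_def complex_eq_iff algebra_simps)
  then show ?thesis
    by (simp add: cmod_power2 power_mult_distrib power_divide)
      (simp add: power2_eq_square field_simps)
qed

definition eval_omega :: "int poly \<Rightarrow> complex" where
  "eval_omega g = poly (map_poly of_int g) omega"

lemma eval_omega_one [simp]: "eval_omega 1 = 1"
  by (simp add: eval_omega_def)

lemma eval_omega_monom [simp]: "eval_omega (monom 1 n) = omega ^ n"
  by (simp add: eval_omega_def map_poly_monom poly_monom)

lemma eval_omega_add [simp]: "eval_omega (p + q) = eval_omega p + eval_omega q"
proof -
  have "map_poly complex_of_int (p + q) = map_poly of_int p + map_poly of_int q"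
    by (rule poly_eqI) (simp add: coeff_map_poly)
  then show ?thesis by (simp add: eval_omega_def)
qed

lemma eval_omega_diff [simp]: "eval_omega (p - q) = eval_omega p - eval_omega q"
proof -
  have "map_poly complex_of_int (p - q) = map_poly of_int p - map_poly of_int q"
    by (rule poly_eqI) (simp add: coeff_map_poly)
  then show ?thesis by (simp add: eval_omega_def)
qed

lemma eval_omega_mult [simp]: "eval_omega (p * q) = eval_omega p * eval_omega q"
proof -
  have "map_poly complex_of_int (p * q) = map_poly of_int p * map_poly of_int q"
    by (rule poly_eqI) (simp add: coeff_map_poly coeff_mult)
  then show ?thesis by (simp add: eval_omega_def)
qed

text \<open>As \<open>omega ^ 3 = 1\<close>, terms whose exponents agree mod 3 share a power of
  \<open>omega\<close>, so the value depends only on \<open>R g\<close>.\<close>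

lemma eval_omega_R_coeff:
  "eval_omega g =
    of_int (R_coeff 0 g) + of_int (R_coeff 1 g) * omega + of_int (R_coeff 2 g) * omega ^ 2"
proof -
  have sum_3: "(\<Sum>i<3. f i) = f 0 + f 1 + f 2" for f :: "nat \<Rightarrow> complex"
    by (simp add: numeral_3_eq_3 numeral_2_eq_2)
  have R_sum: "of_int (R_coeff i g) * omega ^ i =
      (\<Sum>h\<le>degree g. if [h = i] (mod 3) then of_int (coeff g h) * omega ^ h else 0)"
    if "i < 3" for i
  proof -
    have "omega ^ h = omega ^ i" if "[h = i] (mod 3)" for h
      using that unfolding cong_def
      by (subst omega_power_mod[of h], subst omega_power_mod[of i]) simp
    then have "(\<Sum>h | h \<le> degree g \<and> [h = i] (mod 3). of_int (coeff g h) * omega ^ i) =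
        (\<Sum>h | h \<le> degree g \<and> [h = i] (mod 3). of_int (coeff g h) * omega ^ h)"
      by (intro sum.cong) (metis (lifting) mem_Collect_eq)+
    then have "of_int (R_coeff i g) * omega ^ i =
        (\<Sum>h | h \<le> degree g \<and> [h = i] (mod 3). of_int (coeff g h) * omega ^ h)"
      by (simp add: R_coeff_def sum_distrib_right)
    also have "{h. h \<le> degree g \<and> [h = i] (mod 3)} =
        {..degree g} \<inter> {h. [h = i] (mod 3)}" by auto
    finally show ?thesis by (simp add: sum.inter_restrict)
  qed
  have split: "of_int (coeff g h) * omega ^ h =
      (\<Sum>i<3. if [h = i] (mod 3) then of_int (coeff g h) * omega ^ h else 0)" for h
  proof -
    have "h mod 3 = 0 \<or> h mod 3 = 1 \<or> h mod 3 = 2" by presburger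
    then show ?thesis unfolding sum_3 cong_def by auto
  qed
  have "eval_omega g = (\<Sum>h\<le>degree g. of_int (coeff g h) * omega ^ h)"
    by (simp add: eval_omega_def poly_altdef coeff_map_poly degree_map_poly)
  also have "\<dots> = (\<Sum>h\<le>degree g. \<Sum>i<3.
      if [h = i] (mod 3) then of_int (coeff g h) * omega ^ h else 0)"
    by (intro sum.cong refl split)
  also have "\<dots> = (\<Sum>i<3. \<Sum>h\<le>degree g.
      if [h = i] (mod 3) then of_int (coeff g h) * omega ^ h else 0)"
    by (rule sum.swap)
  also have "\<dots> = (\<Sum>i<3. of_int (R_coeff i g) * omega ^ i)"
    by (intro sum.cong refl) (simp add: R_sum)
  finally show ?thesis by (simp add: sum_3)
qed

text \<open>No square exceeds 2, so each difference is -1, 0 or 1, where squaring and absolute value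
  agree.\<close>

lemma abs_diff_sum_eq_2:
  fixes a b c :: int
  assumes "(a - b)\<^sup>2 + (a - c)\<^sup>2 + (b - c)\<^sup>2 = 2"
  shows "\<bar>a - b\<bar> + \<bar>a - c\<bar> + \<bar>b - c\<bar> = 2"
proof -
  have bound: "\<bar>x\<bar> \<le> 1" if "x\<^sup>2 \<le> 2" for x :: int
  proof (rule ccontr)
    assume "\<not> \<bar>x\<bar> \<le> 1"
    then have "2\<^sup>2 \<le> \<bar>x\<bar>\<^sup>2" by (intro power_mono) auto
    with that show False by simp
  qed
  have sq: "x\<^sup>2 = \<bar>x\<bar>" if "\<bar>x\<bar> \<le> 1" for x :: int
  proof -
    from that have "x = -1 \<or> x = 0 \<or> x = 1" by linarith
    then show ?thesis by auto
  qed
  have nonneg: "0 \<le> (a - b)\<^sup>2" "0 \<le> (a - c)\<^sup>2" "0 \<le> (b - c)\<^sup>2" by simp_all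
  have "\<bar>a - b\<bar> \<le> 1" "\<bar>a - c\<bar> \<le> 1" "\<bar>b - c\<bar> \<le> 1"
    using assms nonneg by (intro bound; linarith)+
  with assms show ?thesis by (simp add: sq)
qed

lemma three_specialI:
  assumes "eval_omega g = 0 \<or> cmod (eval_omega g) = 1"
  shows "three_special g"
proof -
  define a b c where "a = R_coeff 0 g" and "b = R_coeff 1 g" and "c = R_coeff 2 g"
  let ?N = "(a - b)\<^sup>2 + (a - c)\<^sup>2 + (b - c)\<^sup>2"
  have N: "(cmod (eval_omega g))\<^sup>2 = of_int ?N / 2"
    unfolding eval_omega_R_coeff a_def b_def c_def by (rule norm_omega_combination)
  from assms have "(of_int ?N :: real) = of_int 0 \<or> (of_int ?N :: real) = of_int 2"
    using N by auto
  then have "?N = 0 \<or> ?N = 2" unfolding of_int_eq_iff .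
  then have "a = b \<and> b = c \<or> \<bar>a - b\<bar> + \<bar>a - c\<bar> + \<bar>b - c\<bar> = 2"
  proof
    assume "?N = 0"
    moreover have "0 \<le> (a - b)\<^sup>2" "0 \<le> (a - c)\<^sup>2" "0 \<le> (b - c)\<^sup>2" by simp_all
    ultimately have "(a - b)\<^sup>2 = 0" "(b - c)\<^sup>2 = 0" by linarith+
    then show ?thesis by simp
  qed (simp add: abs_diff_sum_eq_2)
  then show ?thesis
    unfolding three_special_def special_def R_def a_def b_def c_def by blast
qed

lemma eval_omega_Delta_Suc:
  "eval_omega (Delta [Suc n]) = eval_omega (Delta [n]) + omega ^ Suc n"
  by simp

text \<open>These are partial sums of \<open>omega + omega^2 + 1 + ...\<close>, of period 3 because
  \<open>1 + omega + omega^2 = 0\<close>.\<close>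

lemma eval_omega_Delta_single:
  "eval_omega (Delta [n]) = (if n mod 3 = 0 then 0 else if n mod 3 = 1 then omega else - 1)"
proof (induction n)
  case 0
  then show ?case by (simp add: eval_omega_def)
next
  case (Suc n)
  then show ?case
    unfolding eval_omega_Delta_Suc omega_power_Suc using mod_3_cases[of n]
    by (auto simp del: Delta.simps)
qed

text \<open>The four cases are the ratios \<open>0\<close>, \<open>\<infinity>\<close>, \<open>\<omega>\<close> and \<open>- 1\<close> of \<open>x\<close> to \<open>y\<close>.\<close>

definition admissible :: "complex \<Rightarrow> complex \<Rightarrow> bool" where
  "admissible x y \<longleftrightarrow>
    x = 0 \<and> cmod y = 1 \<or> cmod x = 1 \<and> (y = 0 \<or> x = omega * y \<or> x = - y)"

lemma admissible_step:
  assumes "admissible x y"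
  shows "admissible (x * eval_omega (Delta [n]) - y * omega ^ (n + 1)) x"
proof -
  have admissibleI: "admissible z x" if "cmod x = 1" "z = 0 \<or> z = omega * x \<or> z = - x" for z
    using that by (auto simp: admissible_def norm_mult)
  \<comment> \<open>Used as a rewrite rule, this leaves only linear combinations of \<open>z\<close>
    and \<open>omega * z\<close>.\<close>
  have omega_mult: "omega * (omega * z) = - z - omega * z" for z
  proof -
    have "omega * (omega * z) = omega ^ 2 * z" by (simp add: power2_eq_square)
    then show ?thesis by (simp add: omega_square algebra_simps)
  qed
  have step: "eval_omega (Delta [n]) = 0 \<and> omega ^ (n + 1) = omega \<or>
      eval_omega (Delta [n]) = omega \<and> omega ^ (n + 1) = - 1 - omega \<or>
      eval_omega (Delta [n]) = - 1 \<and> omega ^ (n + 1) = 1"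
    unfolding eval_omega_Delta_single Suc_eq_plus1[symmetric] omega_power_Suc by auto
  consider "x = 0" "cmod y = 1" | "cmod x = 1" "y = 0" | "cmod x = 1" "x = omega * y"
    | "cmod x = 1" "x = - y"
    using assms unfolding admissible_def by blast
  then show ?thesis
  proof cases
    case 1
    \<comment> \<open>The new value is \<open>- y * omega ^ (n + 1)\<close>, a unit, so the new
      ratio is \<infinity>.\<close>
    then show ?thesis by (simp add: admissible_def norm_mult norm_power)
  next
    case 2
    with step show ?thesis by (intro admissibleI) auto
  next
    case 3
    \<comment> \<open>For residues 0, 1, 2 of \<open>n\<close> the new value is \<open>- x\<close>,
      \<open>0\<close>, \<open>omega * x\<close>.\<close>
    from step show ?thesis
      by (intro admissibleI 3(1), elim disjE conjE)
        (simp_all only: 3(2), simp_all add: omega_mult algebra_simps)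
  next
    case 4
    \<comment> \<open>Here the new values are \<open>omega * x\<close>, \<open>- x\<close>,
      \<open>0\<close>.\<close>
    from step show ?thesis
      by (intro admissibleI 4(1), elim disjE conjE)
        (simp_all only: 4(2), simp_all add: algebra_simps)
  qed
qed

lemma admissible_Delta: "admissible (eval_omega (Delta (A @ [b]))) (eval_omega (Delta A))"
proof (induction A arbitrary: b rule: rev_induct)
  case Nil
  \<comment> \<open>A fictitious value 0 before \<open>Delta [] = 1\<close> makes the recursion
    produce \<open>Delta [b]\<close> too.\<close>
  show ?case
    using admissible_step[of 1 0 b] by (simp add: admissible_def del: Delta.simps(2) power_Suc)
next
  case (snoc c A)
  have "Delta ((A @ [c]) @ [b]) = Delta (A @ [c]) * Delta [b] - Delta A * monom 1 (b + 1)"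
    using Delta.simps(3)[of A c b] by (simp del: Delta.simps)
  then show ?case
    using admissible_step[OF snoc, of c b]
    by (simp only: eval_omega_diff eval_omega_mult eval_omega_monom)
qed

theorem theorem4:
  fixes A :: "nat list"
  shows "three_special (Delta A)"
proof (rule three_specialI)
  show "eval_omega (Delta A) = 0 \<or> cmod (eval_omega (Delta A)) = 1"
    \<comment> \<open>The appended 0 is arbitrary: in every admissible pair the second entry is zero
      or a unit.\<close>
    using admissible_Delta[of A 0] by (auto simp: admissible_def norm_mult)
qed

end
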